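(* Let $G=(V,E)$ be a simple undirected graph and let $\mathcal{H}=\{H_v\}_{v\in V}$ be a collection of non-trivial locally finite groups. Then the maximal locally finite subgroup graph of $\mathbb{M}(G,\mathcal{H})$ is isomorphic to $G$: $$\operatorname{MaxSub_{loc}}\big(\mathbb{M}(G,\mathcal{H})\big)\cong G.$$
   Context: A group is locally finite if every finitely generated subgroup of it is finite. A clique of a simple undirected (possibly infinite) graph $G=(V,E)$ is a (possibly infinite) subset $C\subseteq V$ of pairwise adjacent vertices. Partial groups: for a set $X$, $\mathbb{W}(X)$ is the free monoid of words on $X$, $\circ$ is concatenation, $\emptyset$ the empty word, and $X$ is identified with the words of length 1. A partial group is a tuple $\mathbb{M}=(\mathcal{M},\mathbb{D},\Pi,(-)^{-1})$ where $\mathcal{M}$ is a non-empty set; $\mathbb{D}\subseteq\mathbb{W}(\mathcal{M})$ satisfies $\mathcal{M}\subseteq\mathbb{D}$ and ($u\circ v\in\mathbb{D}\Rightarrow u,v\in\mathbb{D}$); $\Pi\colon\mathbb{D}\to\mathcal{M}$ restricts to the identity on $\mathcal{M}$ and if $u\circ v\circ w\in\mathbb{D}$ then $u\circ\Pi(v)\circ w\in\mathbb{D}$ and $\Pi(u\circ v\circ w)=\Pi(u\circ\Pi(v)\circ w)$; $x\mapsto x^{-1}$ is an involutory bijection of $\mathcal{M}$, extended to words by $(x_1,\dots,x_n)^{-1}=(x_n^{-1},\dots,x_1^{-1})$, such that if $u\in\mathbb{D}$ then $u^{-1}\circ u\in\mathbb{D}$ and $\Pi(u^{-1}\circ u)=1:=\Pi(\emptyset)$.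 A homomorphism of partial groups is a map $\varphi\colon\mathcal{M}_1\to\mathcal{M}_2$ whose letterwise extension $\overline{\varphi}$ satisfies $\overline{\varphi}(\mathbb{D}_1)\subseteq\mathbb{D}_2$ and $\Pi_2(\overline{\varphi}(u))=\varphi(\Pi_1(u))$ for $u\in\mathbb{D}_1$; $\mathrm{Part}$ is the resulting category. A subgroup of a partial group $\mathbb{M}$ is a subset $\mathcal{N}\subseteq\mathcal{M}$ closed under inversion, with $\mathbb{W}(\mathcal{N})\subseteq\mathbb{D}$ and $\Pi(\mathbb{W}(\mathcal{N}))\subseteq\mathcal{N}$; it is a group under $(x,y)\mapsto\Pi(x,y)$. For a subgroup $H$ put $H^*=H\smallsetminus\{1\}$. The maximal locally finite subgroup graph $\operatorname{MaxSub_{loc}}(\mathbb{M})$ is the simple undirected graph whose vertices are the non-trivial maximal locally finite subgroups of $\mathbb{M}$ (maximal under inclusion among locally finite subgroups of $\mathbb{M}$), with two distinct vertices $H_1,H_2$ adjacent if and only if there exist $h_1\in H_1^*$ and $h_2\in H_2^*$ with $(h_1,h_2)\in\mathbb{D}$. The partial group $\mathbb{M}(G,\mathcal{H})$: let $G=(V,E)$ be a simple undirected graph and $\mathcal{H}=\{H_v\}_{v\in V}$ a collection of groups. Put $H_v^*=H_v\smallsetminus\{1\}$ (regarded as disjoint sets for different $v$). A word $(g_1,\dots,g_r)\in\mathbb{W}(\bigcup_{v}H_v^* )$ is reduced if consecutive letters lie in different groups $H_v$ (the empty word is reduced), and cyclically reduced if all its cyclic permutations are reduced (the empty word and words of length 1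 are cyclically reduced). $\Pi(w)$ denotes the unique reduced form of a word $w$, i.e. the element of the free product it represents. For a clique $C$ let $\mathbb{M}(C)=(\operatorname{CR}(C),\mathbb{D}(C),\Pi(C),(-)_C^{-1})$, where $\operatorname{CR}(C)$ is the set of cyclically reduced words in $\mathbb{W}(\bigcup_{v\in C}H_v^* )$; $\mathbb{D}(C)$ is the set of words $(u_1,\dots,u_n)\in\mathbb{W}(\operatorname{CR}(C))$ such that $\Pi(u_i\circ u_{i+1}\circ\cdots\circ u_j)\in\operatorname{CR}(C)$ for all $1\le i\le j\le n$; $\Pi(C)(u_1,\dots,u_n)=\Pi(u_1\circ\cdots\circ u_n)$; and $(-)_C^{-1}$ is inversion in the free product $\ast_{v\in C}H_v$. Each $\mathbb{M}(C)$ is a partial group, and $\mathbb{M}(G,\mathcal{H})=(\mathcal{M}(G,\mathcal{H}),\mathbb{D}(G,\mathcal{H}),\Pi(G,\mathcal{H}),(-)^{-1})$ is the colimit in $\mathrm{Part}$ of the $\mathbb{M}(C)$ over the poset of cliques $C$ of $G$ ordered by inclusion (with the inclusion maps). It is identified concretely with $\mathcal{M}(G,\mathcal{H})=\bigcup_C\operatorname{CR}(C)$, $\mathbb{D}(G,\mathcal{H})=\bigcup_C\mathbb{D}(C)$, with product and inversion those of the $\mathbb{M}(C)$. *)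

theory Defs
  imports "HOL-Algebra.Generated_Groups" "HOL-Library.Sublist" "Graph_Theory.Graph_Theory"
begin

section \<open>Graphs and locally finite groups\<close>

text \<open>
  A simple undirected, possibly infinite, graph is a \<^term>\<open>pair_bidirected_digraph\<close>: a loop-free
  symmetric digraph whose arcs are pairs of vertices. Its finite counterpart in the library is
  \<^term>\<open>pair_graph\<close>. For such graphs \<^term>\<open>digraph_iso\<close> is isomorphism of simple graphs.
\<close>

definition clique :: "'v pair_pre_digraph \<Rightarrow> 'v set \<Rightarrow> bool" where
  "clique G C \<longleftrightarrow> C \<subseteq> pverts G \<and> (\<forall>u\<in>C. \<forall>v\<in>C. u \<noteq> v \<longrightarrow> (u, v) \<in> parcs G)"

locale locally_finite_group = group +
  assumes finite_generate: "\<lbrakk>S \<subseteq> carrier G; finite S\<rbrakk> \<Longrightarrow> finite (generate G S)"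


section \<open>Partial groups\<close>

record 'a partial_group = "'a partial_object" +
  pdomain :: "'a list set"
  pprod :: "'a list \<Rightarrow> 'a"
  pinv :: "'a \<Rightarrow> 'a"

locale partial_group =
  fixes M :: "('a, 'b) partial_group_scheme" (structure)
  assumes carrier_nonempty: "carrier M \<noteq> {}"
    and domain_subset: "pdomain M \<subseteq> lists (carrier M)"
    and singleton_domain: "x \<in> carrier M \<Longrightarrow> [x] \<in> pdomain M"
    and append_domain: "u @ v \<in> pdomain M \<Longrightarrow> u \<in> pdomain M \<and> v \<in> pdomain M"
    and prod_closed: "u \<in> pdomain M \<Longrightarrow> pprod M u \<in> carrier M"
    and prod_singleton: "x \<in> carrier M \<Longrightarrow> pprod M [x] = x"
    and prod_domain: "u @ v @ w \<in> pdomain M \<Longrightarrow> u @ [pprod M v] @ w \<in> pdomain M"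
    and prod_assoc: "u @ v @ w \<in> pdomain M \<Longrightarrow> pprod M (u @ v @ w) = pprod M (u @ [pprod M v] @ w)"
    and inv_closed: "x \<in> carrier M \<Longrightarrow> pinv M x \<in> carrier M"
    and inv_inv: "x \<in> carrier M \<Longrightarrow> pinv M (pinv M x) = x"
    and inv_domain: "u \<in> pdomain M \<Longrightarrow> map (pinv M) (rev u) @ u \<in> pdomain M"
    and inv_prod: "u \<in> pdomain M \<Longrightarrow> pprod M (map (pinv M) (rev u) @ u) = pprod M []"

definition pone :: "('a, 'b) partial_group_scheme \<Rightarrow> 'a" where
  "pone M = pprod M []"

definition partial_subgroup :: "('a, 'b) partial_group_scheme \<Rightarrow> 'a set \<Rightarrow> bool" where
  "partial_subgroup M N \<longleftrightarrow>
     N \<subseteq> carrier M \<and> (\<forall>x\<in>N. pinv M x \<in> N) \<and>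
     lists N \<subseteq> pdomain M \<and> (\<forall>u\<in>lists N. pprod M u \<in> N)"

definition subgroup_as_group :: "('a, 'b) partial_group_scheme \<Rightarrow> 'a set \<Rightarrow> 'a monoid" where
  "subgroup_as_group M N = \<lparr>carrier = N, monoid.mult = (\<lambda>x y. pprod M [x, y]), one = pone M\<rparr>"

definition loc_fin_subgroup :: "('a, 'b) partial_group_scheme \<Rightarrow> 'a set \<Rightarrow> bool" where
  "loc_fin_subgroup M N \<longleftrightarrow>
     partial_subgroup M N \<and> locally_finite_group (subgroup_as_group M N)"

definition max_loc_fin_subgroup :: "('a, 'b) partial_group_scheme \<Rightarrow> 'a set \<Rightarrow> bool" where
  "max_loc_fin_subgroup M N \<longleftrightarrow>
     loc_fin_subgroup M N \<and> (\<forall>N'. loc_fin_subgroup M N' \<and> N \<subseteq> N' \<longrightarrow> N' = N)"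

text \<open>
  The condition on arcs is symmetric for a partial group: if \<open>[h1, h2]\<close> lies in the domain,
  then so does \<open>[pinv M h2, pinv M h1]\<close>.
\<close>

definition MaxSub_loc :: "('a, 'b) partial_group_scheme \<Rightarrow> 'a set pair_pre_digraph" where
  "MaxSub_loc M =
     (let Vs = {N. max_loc_fin_subgroup M N \<and> N \<noteq> {pone M}} in
      \<lparr>pverts = Vs,
       parcs = {(N1, N2). N1 \<in> Vs \<and> N2 \<in> Vs \<and> N1 \<noteq> N2 \<and>
                 (\<exists>h1 \<in> N1 - {pone M}. \<exists>h2 \<in> N2 - {pone M}. [h1, h2] \<in> pdomain M)}\<rparr>)"


section \<open>Words in a family of groups\<close>

text \<open>
  A letter is a pair \<open>(v, g)\<close> with \<open>g\<close> an element of \<open>H v\<close>; the index makes the groups disjoint.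
\<close>

definition letters :: "('v \<Rightarrow> ('a, 'b) monoid_scheme) \<Rightarrow> 'v set \<Rightarrow> ('v \<times> 'a) set" where
  "letters H I = (SIGMA v:I. carrier (H v))"

definition nontriv_letters :: "('v \<Rightarrow> ('a, 'b) monoid_scheme) \<Rightarrow> 'v set \<Rightarrow> ('v \<times> 'a) set" where
  "nontriv_letters H I = (SIGMA v:I. carrier (H v) - {\<one>\<^bsub>H v\<^esub>})"

definition reduced_words :: "('v \<Rightarrow> ('a, 'b) monoid_scheme) \<Rightarrow> 'v set \<Rightarrow> ('v \<times> 'a) list set" where
  "reduced_words H I = {w \<in> lists (nontriv_letters H I). successively (\<lambda>x y. fst x \<noteq> fst y) w}"

definition cyc_reduced_words :: "('v \<Rightarrow> ('a, 'b) monoid_scheme) \<Rightarrow> 'v set \<Rightarrow> ('v \<times> 'a) list set" where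
  "cyc_reduced_words H I = {w. \<forall>n. rotate n w \<in> reduced_words H I}"

text \<open>
  The free product of the \<open>H v\<close>, \<open>v \<in> I\<close>, consists of the words in \<^term>\<open>letters H I\<close> modulo the
  equivalence relation generated by the following steps.
\<close>

inductive free_step ::
    "('v \<Rightarrow> ('a, 'b) monoid_scheme) \<Rightarrow> 'v set \<Rightarrow> ('v \<times> 'a) list \<Rightarrow> ('v \<times> 'a) list \<Rightarrow> bool"
  for H I where
  drop_one: "\<lbrakk>u \<in> lists (letters H I); w \<in> lists (letters H I); v \<in> I\<rbrakk>
    \<Longrightarrow> free_step H I (u @ [(v, \<one>\<^bsub>H v\<^esub>)] @ w) (u @ w)"
| merge: "\<lbrakk>u \<in> lists (letters H I); w \<in> lists (letters H I); v \<in> I;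
     g \<in> carrier (H v); h \<in> carrier (H v)\<rbrakk>
    \<Longrightarrow> free_step H I (u @ [(v, g), (v, h)] @ w) (u @ [(v, g \<otimes>\<^bsub>H v\<^esub> h)] @ w)"

definition reduced_form ::
    "('v \<Rightarrow> ('a, 'b) monoid_scheme) \<Rightarrow> 'v set \<Rightarrow> ('v \<times> 'a) list \<Rightarrow> ('v \<times> 'a) list" where
  "reduced_form H I w = (THE r. r \<in> reduced_words H I \<and> equivclp (free_step H I) w r)"

definition word_inv :: "('v \<Rightarrow> ('a, 'b) monoid_scheme) \<Rightarrow> ('v \<times> 'a) list \<Rightarrow> ('v \<times> 'a) list" where
  "word_inv H w = map (\<lambda>(v, g). (v, inv\<^bsub>H v\<^esub> g)) (rev w)"


section \<open>The partial groups of a clique and of a graph\<close>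

text \<open>
  The lists below are lists of words. The empty sublist imposes no condition, since the empty word
  is cyclically reduced.
\<close>

definition clique_domain :: "('v \<Rightarrow> ('a, 'b) monoid_scheme) \<Rightarrow> 'v set \<Rightarrow> ('v \<times> 'a) list list set" where
  "clique_domain H C = {us \<in> lists (cyc_reduced_words H C).
     \<forall>s. sublist s us \<longrightarrow> reduced_form H C (concat s) \<in> cyc_reduced_words H C}"

definition clique_partial_group ::
    "('v \<Rightarrow> ('a, 'b) monoid_scheme) \<Rightarrow> 'v set \<Rightarrow> ('v \<times> 'a) list partial_group" where
  "clique_partial_group H C =
     \<lparr>carrier = cyc_reduced_words H C, pdomain = clique_domain H C,
      pprod = (\<lambda>us. reduced_form H C (concat us)), pinv = word_inv H\<rparr>"

text \<open>
  The colimit of the \<^term>\<open>clique_partial_group H C\<close> over the cliques \<open>C\<close> of \<open>G\<close>, realised as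
  their union. The product is the one of the free product over all vertices; it extends the products
  of the \<^term>\<open>clique_partial_group H C\<close>, see \<open>pprod_graph_partial_group\<close> below.
\<close>

definition graph_partial_group ::
    "'v pair_pre_digraph \<Rightarrow> ('v \<Rightarrow> ('a, 'b) monoid_scheme) \<Rightarrow> ('v \<times> 'a) list partial_group" where
  "graph_partial_group G H =
     \<lparr>carrier = (\<Union>C\<in>{C. clique G C}. carrier (clique_partial_group H C)),
      pdomain = (\<Union>C\<in>{C. clique G C}. pdomain (clique_partial_group H C)),
      pprod = (\<lambda>us. reduced_form H (pverts G) (concat us)), pinv = word_inv H\<rparr>"


section \<open>Well-definedness\<close>

text \<open>
  Reduced forms exist and are unique, and the structures above are partial groups. Uniqueness is
  shown by letting the letters act on reduced words.
\<close>

fun act :: "('v \<Rightarrow> ('a, 'b) monoid_scheme) \<Rightarrow> 'v \<times> 'a \<Rightarrow> ('v \<times> 'a) list \<Rightarrow> ('v \<times> 'a) list" where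
  "act H (v, g) [] = (if g = \<one>\<^bsub>H v\<^esub> then [] else [(v, g)])"
| "act H (v, g) ((w, h) # r) =
     (if w = v then (if g \<otimes>\<^bsub>H v\<^esub> h = \<one>\<^bsub>H v\<^esub> then r else (v, g \<otimes>\<^bsub>H v\<^esub> h) # r)
      else if g = \<one>\<^bsub>H v\<^esub> then (w, h) # r else (v, g) # (w, h) # r)"

lemma Nil_reduced [simp]: "[] \<in> reduced_words H I"
  by (simp add: reduced_words_def)

lemma Cons_reduced:
  "x # r \<in> reduced_words H I \<longleftrightarrow>
     x \<in> nontriv_letters H I \<and> r \<in> reduced_words H I \<and> (r \<noteq> [] \<longrightarrow> fst x \<noteq> fst (hd r))"
  by (cases r) (auto simp: reduced_words_def)

lemma reduced_imp_letters: "r \<in> reduced_words H I \<Longrightarrow> r \<in> lists (letters H I)"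
  by (auto simp: reduced_words_def nontriv_letters_def letters_def)

lemma cyc_reduced_imp_reduced: "w \<in> cyc_reduced_words H I \<Longrightarrow> w \<in> reduced_words H I"
  unfolding cyc_reduced_words_def by (metis (mono_tags) mem_Collect_eq rotate0 id_apply)

lemma Nil_cyc_reduced [simp]: "[] \<in> cyc_reduced_words H I"
  by (simp add: cyc_reduced_words_def)

locale group_family =
  fixes H :: "'v \<Rightarrow> ('a, 'b) monoid_scheme" and I :: "'v set"
  assumes groups: "v \<in> I \<Longrightarrow> group (H v)"
begin

abbreviation "equ \<equiv> equivclp (free_step H I)"

definition reduce :: "('v \<times> 'a) list \<Rightarrow> ('v \<times> 'a) list" where
  "reduce w = foldr (act H) w []"

lemma act_reduced:
  assumes "x \<in> letters H I" "r \<in> reduced_words H I"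
  shows "act H x r \<in> reduced_words H I"
proof -
  obtain v g where x: "x = (v, g)" by fastforce
  interpret group "H v" using groups assms x by (simp add: letters_def)
  show ?thesis
    using assms unfolding x
    by (cases r) (auto simp: Cons_reduced nontriv_letters_def letters_def split: if_splits)
qed

lemma foldr_act_reduced:
  "w \<in> lists (letters H I) \<Longrightarrow> r \<in> reduced_words H I \<Longrightarrow> foldr (act H) w r \<in> reduced_words H I"
  by (induction w) (auto intro: act_reduced)

lemma act_one:
  assumes "v \<in> I" "r \<in> reduced_words H I"
  shows "act H (v, \<one>\<^bsub>H v\<^esub>) r = r"
proof -
  interpret group "H v" using groups assms by simp
  show ?thesis using assms
    by (cases r) (auto simp: Cons_reduced nontriv_letters_def split: if_splits)
qed

lemma act_mult:
  assumes "v \<in> I" "g \<in> carrier (H v)" "h \<in> carrier (H v)" "r \<in> reduced_words H I"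
  shows "act H (v, g) (act H (v, h) r) = act H (v, g \<otimes>\<^bsub>H v\<^esub> h) r"
proof -
  interpret group "H v" using groups assms by simp
  show ?thesis
  proof (cases r)
    case Nil
    then show ?thesis using assms by auto
  next
    case (Cons y r')
    obtain w k where y: "y = (w, k)" by fastforce
    show ?thesis
    proof (cases "w = v")
      case False
      then show ?thesis using assms unfolding Cons y by auto
    next
      case True
      have k: "k \<in> carrier (H v)" "k \<noteq> \<one>\<^bsub>H v\<^esub>"
        and r': "r' = [] \<or> fst (hd r') \<noteq> v"
        using assms(4) True unfolding Cons y by (auto simp: Cons_reduced nontriv_letters_def)
      show ?thesis
      proof (cases "h \<otimes>\<^bsub>H v\<^esub> k = \<one>\<^bsub>H v\<^esub>")
        case hk: True
        have "g \<otimes>\<^bsub>H v\<^esub> h \<otimes>\<^bsub>H v\<^esub> k = g" using assms k hk by (simp add: m_assoc)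
        then show ?thesis using r' hk True unfolding Cons y
          by (cases r') auto
      next
        case False
        then show ?thesis using True assms k unfolding Cons y by (simp add: m_assoc)
      qed
    qed
  qed
qed

lemma foldr_act_step:
  assumes "free_step H I w w'" "r \<in> reduced_words H I"
  shows "foldr (act H) w r = foldr (act H) w' r"
  using assms
  by (induction) (simp_all add: act_one act_mult foldr_act_reduced)

lemma foldr_act_equ:
  assumes "equ w w'" "r \<in> reduced_words H I"
  shows "foldr (act H) w r = foldr (act H) w' r"
  using assms(1)
  by (induction rule: equivclp_induct) (auto dest: foldr_act_step[OF _ assms(2)])

lemma reduce_reduced: "w \<in> lists (letters H I) \<Longrightarrow> reduce w \<in> reduced_words H I"
  unfolding reduce_def by (rule foldr_act_reduced) simp_all

lemma reduce_id: "r \<in> reduced_words H I \<Longrightarrow> reduce r = r"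
proof (induction r)
  case (Cons x r)
  then have "reduce r = r" by (simp add: Cons_reduced)
  with Cons.prems show ?case
    by (cases x; cases r) (auto simp: reduce_def Cons_reduced nontriv_letters_def)
qed (simp add: reduce_def)

lemma free_step_Cons: "free_step H I w w' \<Longrightarrow> x \<in> letters H I \<Longrightarrow> free_step H I (x # w) (x # w')"
proof (induction rule: free_step.induct)
  case (drop_one u w v)
  then show ?case using free_step.drop_one[of "x # u" H I w v] by simp
next
  case (merge u w v g h)
  then show ?case using free_step.merge[of "x # u" H I w v g h] by simp
qed

lemma equ_Cons: "equ w w' \<Longrightarrow> x \<in> letters H I \<Longrightarrow> equ (x # w) (x # w')"
proof (induction rule: equivclp_induct)
  case (step y z)
  then have "equ (x # y) (x # z)"
    by (meson converse_r_into_equivclp free_step_Cons r_into_equivclp)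
  with step show ?case by (meson equivclp_trans)
qed simp

lemma equ_act:
  assumes "x \<in> letters H I" "r \<in> reduced_words H I"
  shows "equ (x # r) (act H x r)"
proof -
  obtain v g where x: "x = (v, g)" by fastforce
  have v: "v \<in> I" "g \<in> carrier (H v)" using assms x by (simp_all add: letters_def)
  interpret group "H v" using groups v by simp
  note L = reduced_imp_letters[OF assms(2)]
  have one: "free_step H I ((v, \<one>\<^bsub>H v\<^esub>) # s) s" if "s \<in> lists (letters H I)" for s
    using drop_one[of "[]" H I s v] that v by simp
  show ?thesis
  proof (cases r)
    case Nil
    then show ?thesis using one[of "[]"] x by auto
  next
    case (Cons y r')
    obtain w k where y: "y = (w, k)" by fastforce
    show ?thesis
    proof (cases "w = v")
      case False
      then show ?thesis using one[OF L] unfolding Cons y x by auto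
    next
      case True
      have k: "k \<in> carrier (H v)" and r': "r' \<in> lists (letters H I)"
        using L True unfolding Cons y by (auto simp: letters_def)
      have m: "free_step H I ((v, g) # (v, k) # r') ((v, g \<otimes>\<^bsub>H v\<^esub> k) # r')"
        using merge[of "[]" H I r' v g k] r' k v by simp
      then have "equ ((v, g) # (v, k) # r') ((v, g \<otimes>\<^bsub>H v\<^esub> k) # r')" by auto
      moreover have "equ ((v, g \<otimes>\<^bsub>H v\<^esub> k) # r') r'" if "g \<otimes>\<^bsub>H v\<^esub> k = \<one>\<^bsub>H v\<^esub>"
        using one[OF r'] that by auto
      ultimately show ?thesis using True unfolding Cons y x
        by (auto intro: equivclp_trans)
    qed
  qed
qed

lemma equ_reduce: "w \<in> lists (letters H I) \<Longrightarrow> equ w (reduce w)"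
proof (induction w)
  case (Cons x w)
  then have "equ (x # w) (x # reduce w)" by (auto intro: equ_Cons)
  moreover have "equ (x # reduce w) (act H x (reduce w))"
    using Cons by (auto intro: equ_act reduce_reduced)
  ultimately show ?case by (simp add: reduce_def) (meson equivclp_trans)
qed (simp add: reduce_def)

lemma equ_imp_reduce_eq: "equ w w' \<Longrightarrow> reduce w = reduce w'"
  unfolding reduce_def by (rule foldr_act_equ) simp_all

lemma ex1_reduced_form:
  assumes "w \<in> lists (letters H I)"
  shows "\<exists>!r. r \<in> reduced_words H I \<and> equ w r"
  using assms by (metis equ_reduce reduce_reduced equ_imp_reduce_eq reduce_id)

lemma reduced_form_eq_reduce:
  assumes "w \<in> lists (letters H I)"
  shows "reduced_form H I w = reduce w"
  unfolding reduced_form_def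
  by (rule the1_equality[OF ex1_reduced_form[OF assms]])
    (simp add: equ_reduce reduce_reduced assms)

lemma reduce_append:
  "reduce (u @ w) = foldr (act H) u (reduce w)"
  by (simp add: reduce_def)

lemma reduce_middle:
  assumes "u \<in> lists (letters H I)" "v \<in> lists (letters H I)" "w \<in> lists (letters H I)"
  shows "reduce (u @ reduce v @ w) = reduce (u @ v @ w)"
  using foldr_act_equ[OF equ_reduce[OF assms(2)] reduce_reduced[OF assms(3)]]
  by (simp add: reduce_append)

lemma word_inv_letters:
  "w \<in> lists (letters H I) \<Longrightarrow> word_inv H w \<in> lists (letters H I)"
proof (induction w)
  case (Cons x w)
  then have "x \<in> letters H I" by simp
  then have "word_inv H [x] \<in> lists (letters H I)"
    using groups by (cases x) (simp add: word_inv_def letters_def group.inv_closed)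
  then show ?case using Cons by (auto simp: word_inv_def)
qed (simp add: word_inv_def)

lemma word_inv_append: "word_inv H (u @ w) = word_inv H w @ word_inv H u"
  by (simp add: word_inv_def)

lemma word_inv_word_inv:
  "w \<in> lists (letters H I) \<Longrightarrow> word_inv H (word_inv H w) = w"
proof (induction w)
  case (Cons x w)
  then show ?case
    using groups by (cases x) (auto simp: word_inv_def rev_map letters_def group.inv_inv)
qed (simp add: word_inv_def)

lemma word_inv_reduced:
  assumes "w \<in> reduced_words H I"
  shows "word_inv H w \<in> reduced_words H I"
proof -
  let ?f = "\<lambda>(v, g). (v, inv\<^bsub>H v\<^esub> g)"
  have "?f x \<in> nontriv_letters H I" if "x \<in> nontriv_letters H I" for x
    using that groups
    by (auto simp: nontriv_letters_def group.inv_closed group.inv_eq_1_iff)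
  moreover have [simp]: "fst (?f x) = fst x" for x by (cases x) simp
  ultimately show ?thesis
    using assms
    by (auto simp: reduced_words_def word_inv_def successively_map eq_commute in_lists_conv_set)
qed

lemma word_inv_cyc_reduced:
  assumes "w \<in> cyc_reduced_words H I"
  shows "word_inv H w \<in> cyc_reduced_words H I"
  unfolding cyc_reduced_words_def
proof safe
  fix n
  have "\<exists>m. rotate n (rev w) = rev (rotate m w)"
    by (metis rotate_rev rev_rev_ident)
  then obtain m where "rotate n (rev w) = rev (rotate m w)" by blast
  then have "rotate n (word_inv H w) = word_inv H (rotate m w)"
    by (simp add: word_inv_def rotate_map)
  then show "rotate n (word_inv H w) \<in> reduced_words H I"
    using assms word_inv_reduced by (simp add: cyc_reduced_words_def)
qed

lemma equ_word_inv:
  assumes "equ w w'"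
  shows "equ (word_inv H w) (word_inv H w')"
proof -
  have st: "equ (word_inv H y) (word_inv H z)" if "free_step H I y z" for y z
    using that
  proof induction
    case (drop_one u w v)
    interpret group "H v" using groups drop_one by simp
    have "free_step H I (word_inv H w @ [(v, \<one>\<^bsub>H v\<^esub>)] @ word_inv H u) (word_inv H w @ word_inv H u)"
      using drop_one by (intro free_step.drop_one word_inv_letters)
    then have "equ (word_inv H w @ [(v, \<one>\<^bsub>H v\<^esub>)] @ word_inv H u) (word_inv H w @ word_inv H u)"
      by (rule r_into_equivclp)
    then show ?case by (simp add: word_inv_def)
  next
    case (merge u w v g h)
    interpret group "H v" using groups merge by simp
    let ?h = "inv\<^bsub>H v\<^esub> h" and ?g = "inv\<^bsub>H v\<^esub> g"
    have "free_step H I (word_inv H w @ [(v, ?h), (v, ?g)] @ word_inv H u)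
        (word_inv H w @ [(v, ?h \<otimes>\<^bsub>H v\<^esub> ?g)] @ word_inv H u)"
      using merge by (intro free_step.merge word_inv_letters inv_closed)
    then have "equ (word_inv H w @ [(v, ?h), (v, ?g)] @ word_inv H u)
        (word_inv H w @ [(v, ?h \<otimes>\<^bsub>H v\<^esub> ?g)] @ word_inv H u)"
      by (rule r_into_equivclp)
    then show ?case using merge by (simp add: word_inv_def inv_mult_group)
  qed
  show ?thesis using assms
  proof (induction rule: equivclp_induct)
    case (step y z)
    then have "equ (word_inv H y) (word_inv H z)"
      using st by (meson equivclp_sym)
    then show ?case using step by (meson equivclp_trans)
  qed simp
qed

lemma reduce_word_inv:
  assumes "w \<in> lists (letters H I)"
  shows "reduce (word_inv H w) = word_inv H (reduce w)"
  by (metis assms equ_imp_reduce_eq equ_reduce equ_word_inv reduce_id reduce_reduced word_inv_reduced)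

lemma reduce_inv_cancel:
  assumes "w \<in> lists (letters H I)" "t \<in> lists (letters H I)"
  shows "reduce (word_inv H w @ w @ t) = reduce t"
  using assms
proof (induction w)
  case (Cons x w)
  obtain v g where x: "x = (v, g)" by fastforce
  have "x \<in> letters H I" using Cons.hyps by simp
  then have v: "v \<in> I" "g \<in> carrier (H v)" by (auto simp: letters_def x)
  interpret group "H v" using groups v by simp
  have r: "reduce (w @ t) \<in> reduced_words H I" using Cons by (intro reduce_reduced) auto
  have "reduce (word_inv H (x # w) @ (x # w) @ t) =
      foldr (act H) (word_inv H w) (act H (v, inv\<^bsub>H v\<^esub> g) (act H (v, g) (reduce (w @ t))))"
    by (simp add: x word_inv_def reduce_def)
  also have "\<dots> = reduce (word_inv H w @ w @ t)"
    using v r by (simp add: act_mult act_one reduce_append)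
  finally show ?case using Cons by simp
qed (simp add: word_inv_def)

lemma concat_letters:
  "us \<in> lists (cyc_reduced_words H I) \<Longrightarrow> concat us \<in> lists (letters H I)"
  by (induction us) (auto dest!: cyc_reduced_imp_reduced reduced_imp_letters)

lemma clique_domain_eq:
  "clique_domain H I = {us \<in> lists (cyc_reduced_words H I).
     \<forall>s. sublist s us \<longrightarrow> reduce (concat s) \<in> cyc_reduced_words H I}"
proof -
  have "reduced_form H I (concat s) = reduce (concat s)"
    if "us \<in> lists (cyc_reduced_words H I)" "sublist s us" for us s
  proof (rule reduced_form_eq_reduce, rule concat_letters)
    show "s \<in> lists (cyc_reduced_words H I)"
      using that set_mono_sublist[of s us] by (auto simp: in_lists_conv_set)
  qed
  then show ?thesis unfolding clique_domain_def by (intro Collect_cong) metis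
qed

lemma concat_word_inv:
  "concat (map (word_inv H) (rev us)) = word_inv H (concat us)"
  by (induction us) (simp_all add: word_inv_append, simp add: word_inv_def)

lemma domainD:
  assumes "us \<in> clique_domain H I"
  shows "us \<in> lists (cyc_reduced_words H I)"
    and "concat us \<in> lists (letters H I)"
    and "sublist s us \<Longrightarrow> s \<in> clique_domain H I"
    and "sublist s us \<Longrightarrow> reduce (concat s) \<in> cyc_reduced_words H I"
    and "reduced_form H I (concat us) = reduce (concat us)"
proof -
  show *: "us \<in> lists (cyc_reduced_words H I)" using assms by (simp add: clique_domain_def)
  show "concat us \<in> lists (letters H I)" using * by (rule concat_letters)
  then show "reduced_form H I (concat us) = reduce (concat us)" by (rule reduced_form_eq_reduce)
  show "sublist s us \<Longrightarrow> s \<in> clique_domain H I"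
    using assms set_mono_sublist[of s us] unfolding clique_domain_def
    by (auto simp: in_lists_conv_set intro: sublist_order.order.trans)
  show "sublist s us \<Longrightarrow> reduce (concat s) \<in> cyc_reduced_words H I"
    using assms unfolding clique_domain_eq by auto
qed

lemma domain_middle:
  assumes "u @ v @ w \<in> clique_domain H I"
  shows "u @ [reduce (concat v)] @ w \<in> clique_domain H I"
    and "reduce (concat (u @ [reduce (concat v)] @ w)) = reduce (concat (u @ v @ w))"
proof -
  have sub: "sublist u (u @ v @ w)" "sublist v (u @ v @ w)" "sublist w (u @ v @ w)"
    by (auto simp: sublist_append)
  note L = domainD(1)[OF domainD(3)[OF assms sub(1)]] domainD(1)[OF domainD(3)[OF assms sub(2)]]
    domainD(1)[OF domainD(3)[OF assms sub(3)]]
  note L' = concat_letters[OF L(1)] concat_letters[OF L(2)] concat_letters[OF L(3)]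
  have red: "reduce (concat (a @ [reduce (concat v)] @ b)) = reduce (concat (a @ v @ b))"
    if "suffix a u" "prefix b w" for a b
    using that L'
    by (simp, intro reduce_middle) (auto simp: suffix_def prefix_def)
  show "reduce (concat (u @ [reduce (concat v)] @ w)) = reduce (concat (u @ v @ w))"
    using red by simp
  have "reduce (concat s) \<in> cyc_reduced_words H I"
    if s: "sublist s (u @ [reduce (concat v)] @ w)" for s
  proof -
    consider "sublist s u" | "sublist s w"
      | a b where "s = a @ [reduce (concat v)] @ b" "suffix a u" "prefix b w"
    proof -
      let ?x = "reduce (concat v)"
      from s consider "sublist s u" | "prefix s (?x # w)" | "sublist s w"
        | a b where "s = a @ b" "suffix a u" "prefix b (?x # w)"
        by (auto simp: sublist_append sublist_Cons_right)
      then show thesis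
      proof cases
        case 2
        then show thesis
        proof (cases s)
          case (Cons y b)
          then show thesis using 2 that(3)[of "[]" b] by simp
        qed (use that(1) in simp)
      next
        case (4 a b)
        then show thesis
        proof (cases b)
          case (Cons y b')
          then show thesis using 4 that(3)[of a b'] by simp
        qed (use 4 that(1) in simp)
      qed (use that in blast)+
    qed
    then show ?thesis
    proof cases
      case 1
      then show ?thesis using domainD(4)[OF assms] sub sublist_order.order.trans by blast
    next
      case 2
      then show ?thesis using domainD(4)[OF assms] sub sublist_order.order.trans by blast
    next
      case (3 a b)
      have "sublist (a @ v @ b) (u @ v @ w)"
        using 3 by (auto simp: suffix_def prefix_def) (metis append.assoc sublist_appendI)
      then show ?thesis using domainD(4)[OF assms] red 3 by metis
    qed
  qed
  moreover have "u @ [reduce (concat v)] @ w \<in> lists (cyc_reduced_words H I)"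
    using L domainD(4)[OF assms sub(2)] by auto
  ultimately show "u @ [reduce (concat v)] @ w \<in> clique_domain H I"
    unfolding clique_domain_eq by blast
qed

lemma domain_inverse:
  assumes "us \<in> clique_domain H I"
  shows "map (word_inv H) (rev us) @ us \<in> clique_domain H I"
    and "reduce (concat (map (word_inv H) (rev us) @ us)) = []"
proof -
  let ?inv = "\<lambda>us. map (word_inv H) (rev us)"
  have inv_red: "reduce (concat (?inv t)) \<in> cyc_reduced_words H I" if "sublist t us" for t
    using domainD(2)[OF domainD(3)[OF assms that]] domainD(4)[OF assms that]
    by (simp only: concat_word_inv reduce_word_inv word_inv_cyc_reduced)
  have cancel: "reduce (concat (?inv a @ a @ t)) = reduce (concat t)"
    if "a \<in> clique_domain H I" "t \<in> clique_domain H I" for a t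
    using reduce_inv_cancel[OF domainD(2)[OF that(1)] domainD(2)[OF that(2)]]
    by (simp only: concat_append concat_word_inv)
  have "[] \<in> clique_domain H I" using domainD(3)[OF assms, of "[]"] by simp
  from cancel[OF assms this] show "reduce (concat (?inv us @ us)) = []"
    by (simp add: reduce_def)
  have "reduce (concat s) \<in> cyc_reduced_words H I" if s: "sublist s (?inv us @ us)" for s
  proof -
    consider "sublist s us" | "sublist s (?inv us)"
      | a b where "s = a @ b" "suffix a (?inv us)" "prefix b us"
      using s by (auto simp: sublist_append)
    then show ?thesis
    proof cases
      case 1
      then show ?thesis by (rule domainD(4)[OF assms])
    next
      case 2
      then obtain t where t: "s = map (word_inv H) t" "sublist t (rev us)"
        using sublist_map_rightE[OF 2] by blast
      then have "sublist (rev t) us" by (simp add: sublist_rev_left)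
      from inv_red[OF this] show ?thesis using t by simp
    next
      case (3 a b)
      then obtain p' where "?inv us = p' @ a" by (auto simp: suffix_def)
      then obtain p q where pq: "rev us = p @ q" "a = map (word_inv H) q"
        by (auto simp: map_eq_append_conv)
      have p: "us = rev q @ rev p" "a = ?inv (rev q)"
        using arg_cong[OF pq(1), of rev] pq(2) by simp_all
      have "prefix (rev q) us" using p(1) by simp
      from prefix_same_cases[OF this 3(3)] have "prefix (rev q) b \<or> prefix b (rev q)" .
      then show ?thesis
      proof
        assume "prefix (rev q) b"
        then obtain t where t: "b = rev q @ t" by (auto simp: prefix_def)
        have sub: "sublist (rev q) us" "sublist t us"
          using 3 t p by (auto simp: prefix_def)
        show ?thesis
          using cancel[OF domainD(3)[OF assms sub(1)] domainD(3)[OF assms sub(2)]]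
            domainD(4)[OF assms sub(2)]
          unfolding 3(1) p(2) t by simp
      next
        assume "prefix b (rev q)"
        then obtain t where t: "rev q = b @ t" by (auto simp: prefix_def)
        have sub: "sublist b us" "sublist t us" using t p by auto
        have L: "concat b \<in> lists (letters H I)" "concat t \<in> lists (letters H I)"
          using domainD(2)[OF domainD(3)[OF assms sub(1)]]
            domainD(2)[OF domainD(3)[OF assms sub(2)]] .
        have "s = ?inv t @ ?inv b @ b" using 3 p t by simp
        moreover have "reduce (word_inv H (concat b) @ concat b) = reduce []"
          using reduce_inv_cancel[OF L(1), of "[]"] by simp
        ultimately have "reduce (concat s) = reduce (concat (?inv t))"
          by (simp only: concat_append concat_word_inv) (simp only: reduce_append, simp add: reduce_def)
        then show ?thesis using inv_red[OF sub(2)] by simp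
      qed
    qed
  qed
  moreover have "?inv us @ us \<in> lists (cyc_reduced_words H I)"
    using domainD(1)[OF assms] by (auto simp: in_lists_conv_set word_inv_cyc_reduced)
  ultimately show "?inv us @ us \<in> clique_domain H I"
    unfolding clique_domain_eq by blast
qed

lemma reduce_cyc_reduced: "x \<in> cyc_reduced_words H I \<Longrightarrow> reduce x = x"
  by (simp add: cyc_reduced_imp_reduced reduce_id)

lemma singleton_clique_domain:
  assumes "x \<in> cyc_reduced_words H I"
  shows "[x] \<in> clique_domain H I"
  using assms unfolding clique_domain_eq
  by (auto simp: sublist_Cons_right prefix_Cons reduce_cyc_reduced reduce_def[of "[]"])

lemma cyc_reduced_word_inv_word_inv:
  "x \<in> cyc_reduced_words H I \<Longrightarrow> word_inv H (word_inv H x) = x"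
  by (intro word_inv_word_inv reduced_imp_letters cyc_reduced_imp_reduced)

theorem partial_group_clique: "partial_group (clique_partial_group H I)"
proof (unfold_locales, unfold clique_partial_group_def partial_group.simps partial_object.simps)
  show "cyc_reduced_words H I \<noteq> {}" using Nil_cyc_reduced by blast
  show "clique_domain H I \<subseteq> lists (cyc_reduced_words H I)"
    using domainD(1) by blast
  fix u v w x
  show "x \<in> cyc_reduced_words H I \<Longrightarrow> [x] \<in> clique_domain H I"
    by (rule singleton_clique_domain)
  show "u @ v \<in> clique_domain H I \<Longrightarrow> u \<in> clique_domain H I \<and> v \<in> clique_domain H I"
    using domainD(3) by blast
  show "u \<in> clique_domain H I \<Longrightarrow> reduced_form H I (concat u) \<in> cyc_reduced_words H I"
    by (simp add: clique_domain_def)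
  show "x \<in> cyc_reduced_words H I \<Longrightarrow> reduced_form H I (concat [x]) = x"
    using domainD(5)[OF singleton_clique_domain] by (simp add: reduce_cyc_reduced)
  show "x \<in> cyc_reduced_words H I \<Longrightarrow> word_inv H x \<in> cyc_reduced_words H I"
    by (rule word_inv_cyc_reduced)
  show "x \<in> cyc_reduced_words H I \<Longrightarrow> word_inv H (word_inv H x) = x"
    by (rule cyc_reduced_word_inv_word_inv)
  show "u \<in> clique_domain H I \<Longrightarrow> map (word_inv H) (rev u) @ u \<in> clique_domain H I"
    by (rule domain_inverse)
  show "reduced_form H I (concat (map (word_inv H) (rev u) @ u)) = reduced_form H I (concat [])"
    if "u \<in> clique_domain H I"
  proof -
    have "[] \<in> clique_domain H I" using domainD(3)[OF that, of "[]"] by simp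
    from domainD(5)[OF this] domainD(5)[OF domain_inverse(1)[OF that]] domain_inverse(2)[OF that]
    show ?thesis by (simp add: reduce_def[of "[]"])
  qed
  assume uvw: "u @ v @ w \<in> clique_domain H I"
  have v: "v \<in> clique_domain H I" using domainD(3)[OF uvw] by blast
  show "u @ [reduced_form H I (concat v)] @ w \<in> clique_domain H I"
    using domain_middle(1)[OF uvw] domainD(5)[OF v] by simp
  show "reduced_form H I (concat (u @ v @ w)) =
      reduced_form H I (concat (u @ [reduced_form H I (concat v)] @ w))"
    using domainD(5)[OF uvw] domainD(5)[OF domain_middle(1)[OF uvw]] domain_middle(2)[OF uvw]
    by (simp only: domainD(5)[OF v])
qed

lemma subfamily: "C \<subseteq> I \<Longrightarrow> group_family H C"
  using groups by (intro group_family.intro) blast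

lemma reduced_form_subset:
  assumes "C \<subseteq> I" "w \<in> lists (letters H C)"
  shows "reduced_form H C w = reduced_form H I w"
proof -
  interpret C: group_family H C by (rule subfamily[OF assms(1)])
  have "w \<in> lists (letters H I)" using assms by (auto simp: letters_def)
  then show ?thesis
    using assms by (simp add: C.reduced_form_eq_reduce reduced_form_eq_reduce C.reduce_def reduce_def)
qed

end

lemma pprod_graph_partial_group:
  assumes "\<And>v. v \<in> pverts G \<Longrightarrow> group (H v)" "clique G C"
    and "us \<in> pdomain (clique_partial_group H C)"
  shows "pprod (graph_partial_group G H) us = pprod (clique_partial_group H C) us"
proof -
  interpret group_family H "pverts G" using assms(1) by (rule group_family.intro)
  have C: "C \<subseteq> pverts G" using assms(2) by (simp add: clique_def)
  interpret C: group_family H C by (rule subfamily[OF C])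
  show ?thesis
    using C.domainD(2)[of us] assms(3) reduced_form_subset[OF C]
    by (simp add: graph_partial_group_def clique_partial_group_def)
qed

theorem partial_group_graph:
  fixes G :: "'v pair_pre_digraph" and H :: "'v \<Rightarrow> ('a, 'b) monoid_scheme"
  assumes groups: "\<And>v. v \<in> pverts G \<Longrightarrow> group (H v)"
  shows "partial_group (graph_partial_group G H)"
proof -
  let ?M = "graph_partial_group G H" and ?C = "clique_partial_group H"
  have pg: "partial_group (?C C)" if "clique G C" for C
  proof -
    interpret group_family H C using groups that by (intro group_family.intro) (auto simp: clique_def)
    show ?thesis by (rule partial_group_clique)
  qed
  have D: "us \<in> pdomain ?M \<longleftrightarrow> (\<exists>C. clique G C \<and> us \<in> pdomain (?C C))" for us
    by (auto simp: graph_partial_group_def)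
  have M: "x \<in> carrier ?M \<longleftrightarrow> (\<exists>C. clique G C \<and> x \<in> carrier (?C C))" for x
    by (auto simp: graph_partial_group_def)
  have P: "pprod ?M us = pprod (?C C) us" if "clique G C" "us \<in> pdomain (?C C)" for us C
    by (rule pprod_graph_partial_group[OF groups that])
  have I: "pinv ?M = pinv (?C C)" for C
    by (simp add: graph_partial_group_def clique_partial_group_def)
  show ?thesis
  proof
    have "clique G {}" by (simp add: clique_def)
    then show "carrier ?M \<noteq> {}" using M partial_group.carrier_nonempty[OF pg] by blast
    show "pdomain ?M \<subseteq> lists (carrier ?M)"
      using D M partial_group.domain_subset[OF pg] by fastforce
    fix u v w x
    show "x \<in> carrier ?M \<Longrightarrow> [x] \<in> pdomain ?M"
      using D M partial_group.singleton_domain[OF pg] by blast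
    show "u @ v \<in> pdomain ?M \<Longrightarrow> u \<in> pdomain ?M \<and> v \<in> pdomain ?M"
      using D partial_group.append_domain[OF pg] by blast
    show "pprod ?M u \<in> carrier ?M" if u: "u \<in> pdomain ?M"
    proof -
      obtain C where C: "clique G C" "u \<in> pdomain (?C C)" using u D by blast
      from partial_group.prod_closed[OF pg[OF C(1)] C(2)] C(1) show ?thesis
        unfolding P[OF C] M by blast
    qed
    show "pprod ?M [x] = x" "pinv ?M x \<in> carrier ?M" "pinv ?M (pinv ?M x) = x"
      if x: "x \<in> carrier ?M"
    proof -
      obtain C where C: "clique G C" "x \<in> carrier (?C C)" using x M by blast
      interpret C: partial_group "?C C" by (rule pg[OF C(1)])
      show "pprod ?M [x] = x"
        using P[OF C(1) C.singleton_domain[OF C(2)]] C.prod_singleton[OF C(2)] by simp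
      show "pinv ?M x \<in> carrier ?M" using C.inv_closed[OF C(2)] M C(1) unfolding I[of C] by blast
      show "pinv ?M (pinv ?M x) = x" using C.inv_inv[OF C(2)] unfolding I[of C] .
    qed
    show "map (pinv ?M) (rev u) @ u \<in> pdomain ?M" if u: "u \<in> pdomain ?M"
    proof -
      obtain C where C: "clique G C" "u \<in> pdomain (?C C)" using u D by blast
      from partial_group.inv_domain[OF pg[OF C(1)] C(2)] C(1) show ?thesis
        unfolding I[of C] D by blast
    qed
    show "pprod ?M (map (pinv ?M) (rev u) @ u) = pprod ?M []" if u: "u \<in> pdomain ?M"
    proof -
      obtain C where C: "clique G C" "u \<in> pdomain (?C C)" using u D by blast
      interpret C: partial_group "?C C" by (rule pg[OF C(1)])
      have "[] \<in> pdomain (?C C)" using C.append_domain[of "[]" u] C by simp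
      then show ?thesis
        using C.inv_prod[OF C(2)] unfolding I[of C]
        by (simp only: P[OF C(1)] C.inv_domain[OF C(2)])
    qed
    assume "u @ v @ w \<in> pdomain ?M"
    then obtain C where C: "clique G C" "u @ v @ w \<in> pdomain (?C C)" using D by blast
    interpret C: partial_group "?C C" by (rule pg[OF C(1)])
    have v: "v \<in> pdomain (?C C)" using C(2) C.append_domain by blast
    show "u @ [pprod ?M v] @ w \<in> pdomain ?M"
      using C.prod_domain[OF C(2)] C(1) unfolding P[OF C(1) v] D by blast
    show "pprod ?M (u @ v @ w) = pprod ?M (u @ [pprod ?M v] @ w)"
      using C.prod_assoc[OF C(2)]
      by (simp only: P[OF C(1) v] P[OF C(1) C(2)] P[OF C(1) C.prod_domain[OF C(2)]])
  qed
qed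

end

theory Submission
  imports Defs
begin

text \<open>
  Write \<open>M\<close> for the partial group of \<open>G\<close> and \<open>H\<close>. The isomorphism sends a vertex \<open>v\<close> to the set of
  cyclically reduced words over the single group \<open>H v\<close>, that is, to the words \<open>[]\<close> and \<open>[(v, g)]\<close>
  with \<open>g\<close> non-trivial. This is a copy of \<open>H v\<close> inside \<open>M\<close> (\<open>loc_fin_vertex_subgroup\<close>), and what has
  to be seen is that every locally finite subgroup of \<open>M\<close> lies in one of these copies
  (\<open>loc_fin_subset_vertex_subgroup\<close>).

  The reason is that \<open>M\<close> consists of cyclically reduced words. If \<open>x\<close> is cyclically reduced of
  length at least 2, no cancellation occurs in the concatenations \<open>x @ \<dots> @ x\<close>, so \<open>x\<close> has infinitely
  many powers and lies in no locally finite subgroup. Hence a locally finite subgroup consists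
  of words of length at most 1. Letters of two different groups cannot both occur in it, because
  their product would be a word of length 2. So all its letters belong to the same group \<open>H v\<close>.

  As the \<open>H v\<close> are non-trivial, their copies are pairwise incomparable, and so they are exactly the
  non-trivial maximal locally finite subgroups. A product of a letter from \<open>H v\<close> and one from \<open>H w\<close>
  with \<open>v \<noteq> w\<close> is defined precisely when some clique contains both \<open>v\<close> and \<open>w\<close>, that is, when
  \<open>v\<close> and \<open>w\<close> are adjacent.
\<close>

section \<open>Powers of cyclically reduced words\<close>

lemma cyc_reduced_last_hd:
  assumes "x \<in> cyc_reduced_words H I" "2 \<le> length x"
  shows "fst (last x) \<noteq> fst (hd x)"
proof -
  obtain a y where x: "x = a # y" "y \<noteq> []"
    using assms(2) by (cases x; cases "tl x") auto
  have "rotate 1 x \<in> reduced_words H I"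
    using assms(1) unfolding cyc_reduced_words_def by blast
  then have "successively (\<lambda>x y. fst x \<noteq> fst y) (y @ [a])"
    by (simp add: x reduced_words_def)
  then show ?thesis using x by (simp add: successively_append_iff)
qed

lemma reduced_append:
  assumes "u \<in> reduced_words H I" "w \<in> reduced_words H I"
    and "u \<noteq> [] \<Longrightarrow> w \<noteq> [] \<Longrightarrow> fst (last u) \<noteq> fst (hd w)"
  shows "u @ w \<in> reduced_words H I"
  using assms by (auto simp: reduced_words_def successively_append_iff)

text \<open>
  At each seam between two copies of \<open>x\<close> the last letter of \<open>x\<close> meets the first one, and these lie
  in different groups because a rotation of \<open>x\<close> makes them neighbours. Length 1 has to be excluded:
  a single letter is cyclically reduced, but its square is not reduced.
\<close>
lemma cyc_reduced_power_reduced: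
  assumes "x \<in> cyc_reduced_words H I" "2 \<le> length x"
  shows "concat (replicate n x) \<in> reduced_words H I"
proof (induction n)
  case (Suc n)
  have "hd (concat (replicate n x)) = hd x" if "concat (replicate n x) \<noteq> []"
    using that assms(2) by (cases n) auto
  with Suc show ?case
    using cyc_reduced_last_hd[OF assms] cyc_reduced_imp_reduced[OF assms(1)]
    by (auto intro!: reduced_append)
qed simp

lemma cyc_reduced_words_mono: "C \<subseteq> D \<Longrightarrow> cyc_reduced_words H C \<subseteq> cyc_reduced_words H D"
  by (auto simp: cyc_reduced_words_def reduced_words_def nontriv_letters_def)

section \<open>The copy of a vertex group\<close>

lemma reduced_words_single:
  "reduced_words H {v} = insert [] ((\<lambda>g. [(v, g)]) ` (carrier (H v) - {\<one>\<^bsub>H v\<^esub>}))"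
proof (rule Set.set_eqI)
  fix w
  show "w \<in> reduced_words H {v} \<longleftrightarrow>
      w \<in> insert [] ((\<lambda>g. [(v, g)]) ` (carrier (H v) - {\<one>\<^bsub>H v\<^esub>}))"
  proof (cases w)
    case (Cons x r)
    then show ?thesis
      by (cases x; cases r) (auto simp: Cons_reduced nontriv_letters_def)
  qed simp
qed

lemma cyc_reduced_words_single:
  "cyc_reduced_words H {v} = insert [] ((\<lambda>g. [(v, g)]) ` (carrier (H v) - {\<one>\<^bsub>H v\<^esub>}))"
proof (rule subset_antisym)
  show "cyc_reduced_words H {v} \<subseteq> insert [] ((\<lambda>g. [(v, g)]) ` (carrier (H v) - {\<one>\<^bsub>H v\<^esub>}))"
    using cyc_reduced_imp_reduced unfolding reduced_words_single[symmetric] by blast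
qed (auto simp: cyc_reduced_words_def reduced_words_single)

text \<open>
  Acting on the empty word normalises a single letter: it sends \<open>(v, g)\<close> to \<open>[(v, g)]\<close>, or to \<open>[]\<close>
  if \<open>g\<close> is trivial. This is the embedding of \<open>H v\<close>; that it is multiplicative will be the
  compatibility of the action with products in \<open>H v\<close>.
\<close>
lemma cyc_reduced_words_single_eq_act:
  assumes "group (H v)"
  shows "cyc_reduced_words H {v} = (\<lambda>g. act H (v, g) []) ` carrier (H v)"
proof -
  have "\<one>\<^bsub>H v\<^esub> \<in> carrier (H v)" using assms by (simp add: group.is_monoid)
  then show ?thesis unfolding cyc_reduced_words_single by (auto simp: image_iff)
qed

text \<open>
  For a single vertex, reduced and cyclically reduced words coincide, so that every product of
  words is defined.
\<close>
lemma clique_domain_single: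
  assumes "group (H v)"
  shows "clique_domain H {v} = lists (cyc_reduced_words H {v})"
proof -
  interpret group_family H "{v}" using assms by (intro group_family.intro) simp
  have "reduce (concat s) \<in> cyc_reduced_words H {v}"
    if "us \<in> lists (cyc_reduced_words H {v})" "sublist s us" for us s
  proof -
    have "s \<in> lists (cyc_reduced_words H {v})"
      using that set_mono_sublist[of s us] by (auto simp: in_lists_conv_set)
    then have "reduce (concat s) \<in> reduced_words H {v}"
      by (intro reduce_reduced concat_letters)
    then show ?thesis by (simp add: reduced_words_single cyc_reduced_words_single)
  qed
  then show ?thesis unfolding clique_domain_eq by blast
qed

locale vertex_groups =
  fixes G :: "'v pair_pre_digraph" and H :: "'v \<Rightarrow> ('a, 'b) monoid_scheme"
  assumes vertex_group: "v \<in> pverts G \<Longrightarrow> group (H v)"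
begin

sublocale group_family H "pverts G"
  by (rule group_family.intro) (rule vertex_group)

abbreviation "M \<equiv> graph_partial_group G H"

lemma carrier_M: "x \<in> carrier M \<longleftrightarrow> (\<exists>C. clique G C \<and> x \<in> cyc_reduced_words H C)"
  by (auto simp: graph_partial_group_def clique_partial_group_def)

lemma carrier_M_cyc_reduced: "x \<in> carrier M \<Longrightarrow> x \<in> cyc_reduced_words H (pverts G)"
  using cyc_reduced_words_mono unfolding carrier_M clique_def by blast

lemma pdomain_M: "us \<in> pdomain M \<longleftrightarrow> (\<exists>C. clique G C \<and> us \<in> clique_domain H C)"
  by (auto simp: graph_partial_group_def clique_partial_group_def)

lemma pprod_M: "pprod M us = reduced_form H (pverts G) (concat us)"
  by (simp add: graph_partial_group_def)

lemma pprod_M_reduced: "concat us \<in> reduced_words H (pverts G) \<Longrightarrow> pprod M us = concat us"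
  by (simp add: pprod_M reduced_form_eq_reduce reduced_imp_letters reduce_id)

lemma pone_M [simp]: "pone M = []"
  unfolding pone_def by (subst pprod_M_reduced) simp_all

lemma partial_subgroup_vertex:
  assumes v: "v \<in> pverts G"
  shows "partial_subgroup M (cyc_reduced_words H {v})"
proof -
  let ?N = "cyc_reduced_words H {v}"
  have cl: "clique G {v}" using v by (simp add: clique_def)
  interpret C: group_family H "{v}" using v by (intro subfamily) simp
  have D: "clique_domain H {v} = lists ?N" using vertex_group[OF v] by (rule clique_domain_single)
  have "?N \<subseteq> carrier M" using cl carrier_M by blast
  moreover have "pinv M x \<in> ?N" if "x \<in> ?N" for x
    using C.word_inv_cyc_reduced[OF that] by (simp add: graph_partial_group_def)
  moreover have "lists ?N \<subseteq> pdomain M" using cl pdomain_M D by blast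
  moreover have "pprod M u \<in> ?N" if "u \<in> lists ?N" for u
  proof -
    have "u \<in> pdomain (clique_partial_group H {v})"
      using that D by (simp add: clique_partial_group_def)
    from partial_group.prod_closed[OF C.partial_group_clique this]
      pprod_graph_partial_group[OF vertex_group cl this]
    show ?thesis by (simp add: clique_partial_group_def)
  qed
  ultimately show ?thesis unfolding partial_subgroup_def by blast
qed

lemma act_hom_vertex:
  assumes v: "v \<in> pverts G"
  shows "(\<lambda>g. act H (v, g) []) \<in> hom (H v) (subgroup_as_group M (cyc_reduced_words H {v}))"
proof (rule homI)
  let ?\<phi> = "\<lambda>g. act H (v, g) []"
  interpret group "H v" using vertex_group[OF v] .
  fix g h assume g: "g \<in> carrier (H v)" and h: "h \<in> carrier (H v)"
  show "?\<phi> g \<in> carrier (subgroup_as_group M (cyc_reduced_words H {v}))"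
    using g vertex_group[OF v] by (simp only: cyc_reduced_words_single_eq_act)
      (simp add: subgroup_as_group_def)
  have red: "?\<phi> k \<in> reduced_words H (pverts G)" if "k \<in> carrier (H v)" for k
    using that v by (intro act_reduced) (auto simp: letters_def)
  have foldr: "foldr (act H) (?\<phi> g) r = act H (v, g) r" if "r \<in> reduced_words H (pverts G)" for r
    using act_one[OF v that] by simp
  have "pprod M [?\<phi> g, ?\<phi> h] = reduce (?\<phi> g @ ?\<phi> h)"
    using reduced_imp_letters[OF red[OF g]] reduced_imp_letters[OF red[OF h]]
    by (simp only: pprod_M, subst reduced_form_eq_reduce) auto
  also have "\<dots> = act H (v, g) (?\<phi> h)"
    by (simp only: reduce_append reduce_id[OF red[OF h]] foldr[OF red[OF h]])
  also have "\<dots> = ?\<phi> (g \<otimes>\<^bsub>H v\<^esub> h)" using v g h by (intro act_mult) simp_all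
  finally show "?\<phi> (g \<otimes>\<^bsub>H v\<^esub> h) =
      ?\<phi> g \<otimes>\<^bsub>subgroup_as_group M (cyc_reduced_words H {v})\<^esub> ?\<phi> h"
    by (simp add: subgroup_as_group_def)
qed

lemma loc_fin_vertex_subgroup:
  assumes v: "v \<in> pverts G" and lf: "locally_finite_group (H v)"
  shows "loc_fin_subgroup M (cyc_reduced_words H {v})"
proof -
  let ?\<phi> = "\<lambda>g. act H (v, g) []" and ?K = "subgroup_as_group M (cyc_reduced_words H {v})"
  interpret Hv: locally_finite_group "H v" by (rule lf)
  note im = cyc_reduced_words_single_eq_act[of H v, OF vertex_group[OF v]]
  have "?K\<lparr>carrier := ?\<phi> ` carrier (H v), one := ?\<phi> \<one>\<^bsub>H v\<^esub>\<rparr> = ?K"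
    by (simp only: im[symmetric]) (simp add: subgroup_as_group_def)
  then have "group ?K" using Hv.hom_imp_img_group[OF act_hom_vertex[OF v]] by simp
  then interpret \<phi>: group_hom "H v" ?K ?\<phi>
    using act_hom_vertex[OF v] by (intro group_hom.intro group_hom_axioms.intro Hv.is_group)
  have "finite (generate ?K S)" if S: "S \<subseteq> carrier ?K" "finite S" for S
  proof -
    have "S \<subseteq> ?\<phi> ` carrier (H v)" using S(1) im by (simp add: subgroup_as_group_def)
    then obtain T where "T \<subseteq> carrier (H v)" "finite T" "S = ?\<phi> ` T"
      using S(2) by (meson finite_subset_image)
    then show ?thesis using Hv.finite_generate \<phi>.generate_img by simp
  qed
  then have "locally_finite_group ?K" by unfold_locales
  then show ?thesis
    unfolding loc_fin_subgroup_def using partial_subgroup_vertex[OF v] by blast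
qed

section \<open>Locally finite subgroups\<close>

text \<open>
  The powers of a longer word are its repeated concatenations, which are already reduced and have
  pairwise different lengths, so they form an infinite subset of the subgroup generated by the word.
\<close>
lemma loc_fin_length_le_1:
  assumes N: "loc_fin_subgroup M N" and x: "x \<in> N"
  shows "length x \<le> 1"
proof (rule ccontr)
  assume "\<not> length x \<le> 1"
  then have len: "2 \<le> length x" by simp
  let ?K = "subgroup_as_group M N" and ?p = "\<lambda>n. concat (replicate n x)"
  interpret K: locally_finite_group ?K using N by (simp add: loc_fin_subgroup_def)
  have "x \<in> carrier M" using N x by (auto simp: loc_fin_subgroup_def partial_subgroup_def)
  then have red: "?p n \<in> reduced_words H (pverts G)" for n
    using carrier_M_cyc_reduced len by (intro cyc_reduced_power_reduced)
  have "?p n \<in> generate ?K {x}" for n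
  proof (induction n)
    case 0
    then show ?case using generate.one[of ?K "{x}"] by (simp add: subgroup_as_group_def)
  next
    case (Suc n)
    have "x \<otimes>\<^bsub>?K\<^esub> ?p n \<in> generate ?K {x}"
      by (rule generate.eng[OF generate.incl Suc]) simp
    moreover have "x \<otimes>\<^bsub>?K\<^esub> ?p n = ?p (Suc n)"
      using pprod_M_reduced[of "[x, ?p n]"] red[of "Suc n"] by (simp add: subgroup_as_group_def)
    ultimately show ?case by simp
  qed
  then have "range ?p \<subseteq> generate ?K {x}" by blast
  moreover have "finite (generate ?K {x})"
    using x by (intro K.finite_generate) (simp_all add: subgroup_as_group_def)
  moreover have "inj ?p"
  proof (rule injI)
    fix m n assume "?p m = ?p n"
    then have "length (?p m) = length (?p n)" by simp
    then show "m = n" using len by (auto simp: length_concat sum_list_replicate)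
  qed
  ultimately show False using finite_subset range_inj_infinite by blast
qed

text \<open>
  The letters of a locally finite subgroup come from a single vertex group: a product of two letters
  from different groups is already reduced of length 2.
\<close>
lemma loc_fin_subset_vertex_subgroup:
  assumes N: "loc_fin_subgroup M N" and x: "(v, g) # r \<in> N"
  shows "v \<in> pverts G" "N \<subseteq> cyc_reduced_words H {v}"
proof -
  have letter: "w \<in> pverts G \<and> h \<in> carrier (H w) - {\<one>\<^bsub>H w\<^esub>} \<and> s = []"
    if "(w, h) # s \<in> N" for w h s
  proof -
    have "(w, h) # s \<in> carrier M"
      using N that by (auto simp: loc_fin_subgroup_def partial_subgroup_def)
    then have "(w, h) # s \<in> reduced_words H (pverts G)"
      by (intro cyc_reduced_imp_reduced carrier_M_cyc_reduced)
    then show ?thesis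
      using loc_fin_length_le_1[OF N that] by (auto simp: Cons_reduced nontriv_letters_def)
  qed
  show v: "v \<in> pverts G" using letter[OF x] by blast
  show "N \<subseteq> cyc_reduced_words H {v}"
  proof
    fix y assume y: "y \<in> N"
    show "y \<in> cyc_reduced_words H {v}"
    proof (cases y)
      case (Cons a s)
      obtain w h where a: "a = (w, h)" by fastforce
      have "w = v"
      proof (rule ccontr)
        assume "w \<noteq> v"
        have xy: "[(v, g)] \<in> N" "[(w, h)] \<in> N" using x y Cons a letter by auto
        then have "pprod M [[(v, g)], [(w, h)]] \<in> N"
          using N by (simp add: loc_fin_subgroup_def partial_subgroup_def)
        moreover have "pprod M [[(v, g)], [(w, h)]] = [(v, g), (w, h)]"
          using \<open>w \<noteq> v\<close> letter[OF xy(1)] letter[OF xy(2)]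
          by (subst pprod_M_reduced) (auto simp: Cons_reduced nontriv_letters_def)
        ultimately show False using loc_fin_length_le_1[OF N] by fastforce
      qed
      then show ?thesis using letter[of w h s] y Cons a by (auto simp: cyc_reduced_words_single)
    qed simp
  qed
qed

section \<open>The maximal locally finite subgroup graph\<close>

lemma vertex_subgroup_subset_imp_eq:
  assumes "carrier (H v) \<noteq> {\<one>\<^bsub>H v\<^esub>}" "v \<in> pverts G"
    and "cyc_reduced_words H {v} \<subseteq> cyc_reduced_words H {w}"
  shows "v = w"
proof -
  have "\<one>\<^bsub>H v\<^esub> \<in> carrier (H v)" using vertex_group[OF assms(2)] by (simp add: group.is_monoid)
  then obtain g where "g \<in> carrier (H v)" "g \<noteq> \<one>\<^bsub>H v\<^esub>" using assms(1) by blast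
  then have "[(v, g)] \<in> cyc_reduced_words H {w}" using assms(3) by (auto simp: cyc_reduced_words_single)
  then show ?thesis by (auto simp: cyc_reduced_words_single)
qed

lemma pverts_MaxSub_loc:
  assumes lf: "\<And>v. v \<in> pverts G \<Longrightarrow> locally_finite_group (H v)"
    and nt: "\<And>v. v \<in> pverts G \<Longrightarrow> carrier (H v) \<noteq> {\<one>\<^bsub>H v\<^esub>}"
  shows "pverts (MaxSub_loc M) = (\<lambda>v. cyc_reduced_words H {v}) ` pverts G"
proof -
  let ?N = "\<lambda>v. cyc_reduced_words H {v}"
  have sub: "\<exists>v\<in>pverts G. N \<subseteq> ?N v" if N: "loc_fin_subgroup M N" "N \<noteq> {[]}" for N
  proof -
    interpret K: locally_finite_group "subgroup_as_group M N"
      using N by (simp add: loc_fin_subgroup_def)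
    have "[] \<in> N" using K.one_closed by (simp add: subgroup_as_group_def)
    with N(2) obtain x where "x \<in> N" "x \<noteq> []" by blast
    then obtain v g r where "(v, g) # r \<in> N" by (cases x) auto
    from loc_fin_subset_vertex_subgroup[OF N(1) this] show ?thesis by blast
  qed
  have nontriv: "?N v \<noteq> {[]}" if "v \<in> pverts G" for v
  proof -
    have "\<one>\<^bsub>H v\<^esub> \<in> carrier (H v)" using vertex_group[OF that] by (simp add: group.is_monoid)
    then show ?thesis using nt[OF that] by (auto simp: cyc_reduced_words_single)
  qed
  have "max_loc_fin_subgroup M (?N v)" if v: "v \<in> pverts G" for v
    unfolding max_loc_fin_subgroup_def
  proof (intro conjI allI impI)
    show "loc_fin_subgroup M (?N v)" using v lf by (intro loc_fin_vertex_subgroup)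
    fix N' assume N': "loc_fin_subgroup M N' \<and> ?N v \<subseteq> N'"
    then have "N' \<noteq> {[]}" using nontriv[OF v] Nil_cyc_reduced by blast
    then obtain w where "w \<in> pverts G" "N' \<subseteq> ?N w" using sub N' by blast
    then show "N' = ?N v"
      using N' vertex_subgroup_subset_imp_eq[OF nt[OF v] v, of w] by blast
  qed
  moreover have "N \<in> ?N ` pverts G" if N: "max_loc_fin_subgroup M N" "N \<noteq> {[]}" for N
  proof -
    obtain v where "v \<in> pverts G" "N \<subseteq> ?N v"
      using sub[of N] N by (auto simp: max_loc_fin_subgroup_def)
    then show ?thesis
      using N(1) loc_fin_vertex_subgroup lf unfolding max_loc_fin_subgroup_def by blast
  qed
  ultimately show ?thesis using nontriv by (auto simp: MaxSub_loc_def Let_def)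
qed

text \<open>
  A domain element is a word over a single clique, which gives one direction. For the other one,
  \<open>{v, w}\<close> is itself a clique if \<open>v\<close> and \<open>w\<close> are adjacent, and the product of the two letters is the
  cyclically reduced word of length 2.
\<close>
lemma letters_pdomain_iff:
  assumes vw: "v \<noteq> w" "v \<in> pverts G" "w \<in> pverts G" and sym: "sym (parcs G)"
    and g: "g \<in> carrier (H v) - {\<one>\<^bsub>H v\<^esub>}" and h: "h \<in> carrier (H w) - {\<one>\<^bsub>H w\<^esub>}"
  shows "[[(v, g)], [(w, h)]] \<in> pdomain M \<longleftrightarrow> (v, w) \<in> parcs G"
proof
  assume "[[(v, g)], [(w, h)]] \<in> pdomain M"
  then obtain C where C: "clique G C" "[(v, g)] \<in> cyc_reduced_words H C" "[(w, h)] \<in> cyc_reduced_words H C"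
    by (auto simp: pdomain_M clique_domain_def)
  then have "v \<in> C" "w \<in> C"
    by (auto dest!: cyc_reduced_imp_reduced simp: Cons_reduced nontriv_letters_def)
  then show "(v, w) \<in> parcs G" using C(1) vw(1) by (auto simp: clique_def)
next
  let ?C = "{v, w}"
  assume "(v, w) \<in> parcs G"
  then have cl: "clique G ?C" using vw sym by (auto simp: clique_def dest: symD)
  interpret C: group_family H ?C using vw by (intro subfamily) simp
  have single: "[(v, g)] \<in> cyc_reduced_words H ?C" "[(w, h)] \<in> cyc_reduced_words H ?C"
    using g h by (auto simp: cyc_reduced_words_def Cons_reduced nontriv_letters_def)
  have "rotate n [(v, g), (w, h)] \<in> {[(v, g), (w, h)], [(w, h), (v, g)]}" for n
    by (induction n) auto
  moreover have "{[(v, g), (w, h)], [(w, h), (v, g)]} \<subseteq> reduced_words H ?C"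
    using g h vw(1) by (auto simp: Cons_reduced nontriv_letters_def)
  ultimately have two: "[(v, g), (w, h)] \<in> cyc_reduced_words H ?C"
    unfolding cyc_reduced_words_def by blast
  have "C.reduce (concat s) \<in> cyc_reduced_words H ?C" if "sublist s [[(v, g)], [(w, h)]]" for s
  proof -
    have "concat s \<in> cyc_reduced_words H ?C"
      using that single two by (auto simp: sublist_Cons_right prefix_Cons)
    then show ?thesis by (simp add: C.reduce_cyc_reduced)
  qed
  then have "[[(v, g)], [(w, h)]] \<in> clique_domain H ?C"
    unfolding C.clique_domain_eq using single by simp
  then show "[[(v, g)], [(w, h)]] \<in> pdomain M" using cl pdomain_M by blast
qed

end

lemma digraph_iso_with_projI:
  assumes bij: "bij_betw f (pverts G) (pverts K)"
    and wf: "parcs G \<subseteq> pverts G \<times> pverts G"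
    and arcs: "parcs K = map_prod f f ` parcs G"
  shows "digraph_iso (with_proj G) (with_proj K)"
proof -
  let ?h = "\<lparr>iso_verts = f, iso_arcs = map_prod f f, iso_head = snd, iso_tail = fst\<rparr>"
  have inj: "inj_on f (pverts G)" and im: "f ` pverts G = pverts K"
    using bij by (auto simp: bij_betw_def)
  have "wf_digraph (with_proj G)" using wf by unfold_locales auto
  moreover have "inj_on (map_prod f f) (parcs G)"
    using map_prod_inj_on[OF inj inj] wf by (rule inj_on_subset)
  ultimately have "pre_digraph.digraph_isomorphism (with_proj G) ?h"
    using inj by (simp add: pre_digraph.digraph_isomorphism_def)
  moreover have "with_proj K = app_iso ?h (with_proj G)"
    by (simp add: app_iso_def with_proj_def im arcs)
  ultimately show ?thesis unfolding digraph_iso_def by blast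
qed

theorem theorem6p7:
  fixes G :: "'v pair_pre_digraph"
    and H :: "'v \<Rightarrow> ('a, 'b) monoid_scheme"
  assumes "pair_bidirected_digraph G"
    and "\<And>v. v \<in> pverts G \<Longrightarrow> locally_finite_group (H v)"
    and "\<And>v. v \<in> pverts G \<Longrightarrow> carrier (H v) \<noteq> {\<one>\<^bsub>H v\<^esub>}"
  shows "digraph_iso (with_proj (MaxSub_loc (graph_partial_group G H))) (with_proj G)"
proof -
  interpret G: pair_bidirected_digraph G by (rule assms(1))
  interpret vertex_groups G H
    using assms(2) by (intro vertex_groups.intro) (simp add: locally_finite_group_def)
  let ?f = "\<lambda>v. cyc_reduced_words H {v}" and ?K = "MaxSub_loc (graph_partial_group G H)"
  have sym: "sym (parcs G)" using G.arcs_symmetric by (auto intro: symI)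
  have wf: "parcs G \<subseteq> pverts G \<times> pverts G"
    using G.in_arcsD1 G.in_arcsD2 by auto
  have verts: "pverts ?K = ?f ` pverts G" by (rule pverts_MaxSub_loc[OF assms(2,3)])
  have eq_iff: "?f v = ?f w \<longleftrightarrow> v = w" if "v \<in> pverts G" for v w
    using vertex_subgroup_subset_imp_eq[OF assms(3)[OF that] that, of w] by auto
  have ex: "\<exists>g. g \<in> carrier (H v) - {\<one>\<^bsub>H v\<^esub>}" if "v \<in> pverts G" for v
  proof -
    interpret group "H v" by (rule vertex_group[OF that])
    show ?thesis using assms(3)[OF that] one_closed by blast
  qed
  have arc: "(?f v, ?f w) \<in> parcs ?K \<longleftrightarrow> (v, w) \<in> parcs G"
    if v: "v \<in> pverts G" and w: "w \<in> pverts G" for v w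
  proof (cases "v = w")
    case True
    then show ?thesis using G.no_loops' by (auto simp: MaxSub_loc_def Let_def)
  next
    case False
    have "(?f v, ?f w) \<in> parcs ?K \<longleftrightarrow>
        (\<exists>x\<in>?f v - {[]}. \<exists>y\<in>?f w - {[]}. [x, y] \<in> pdomain M)"
      using v w verts eq_iff[OF v] False by (auto simp: MaxSub_loc_def Let_def)
    also have "\<dots> \<longleftrightarrow> (\<exists>g \<in> carrier (H v) - {\<one>\<^bsub>H v\<^esub>}. \<exists>h \<in> carrier (H w) - {\<one>\<^bsub>H w\<^esub>}.
        [[(v, g)], [(w, h)]] \<in> pdomain M)"
      by (auto simp: cyc_reduced_words_single)
    also have "\<dots> \<longleftrightarrow> (v, w) \<in> parcs G"
      using letters_pdomain_iff[OF False v w sym] ex[OF v] ex[OF w] by blast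
    finally show ?thesis .
  qed
  have "parcs ?K \<subseteq> pverts ?K \<times> pverts ?K" by (auto simp: MaxSub_loc_def Let_def)
  then have "parcs ?K = map_prod ?f ?f ` parcs G"
    unfolding verts
  proof (intro subset_antisym subsetI)
    fix e assume K: "parcs ?K \<subseteq> ?f ` pverts G \<times> ?f ` pverts G" and e: "e \<in> parcs ?K"
    then obtain v w where vw: "v \<in> pverts G" "w \<in> pverts G" "e = (?f v, ?f w)" by blast
    then have "(v, w) \<in> parcs G" using e arc by blast
    then show "e \<in> map_prod ?f ?f ` parcs G" unfolding vw(3) by (rule rev_image_eqI) simp
  next
    fix e assume "e \<in> map_prod ?f ?f ` parcs G"
    then obtain v w where vw: "(v, w) \<in> parcs G" "e = (?f v, ?f w)" by auto
    then have "v \<in> pverts G" "w \<in> pverts G" using wf by auto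
    then show "e \<in> parcs ?K" using vw arc by blast
  qed
  moreover have "bij_betw ?f (pverts G) (pverts ?K)"
    unfolding verts using eq_iff by (auto simp: bij_betw_def inj_on_def)
  ultimately have "digraph_iso (with_proj G) (with_proj ?K)"
    using wf by (intro digraph_iso_with_projI)
  then show ?thesis by (rule digraph_iso_swap[OF G.wf_digraph])
qed

end
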